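(* Let $k$ be a positive integer and $q\ge2$ an integer, and let $S\subset\mathbb{R}^{k+1}$ be the one-row Hermite normal form simplex with non-trivial row $(q^{k-1},\dots,q,1,q^k)$, i.e. the convex hull of $0,e_1,\dots,e_k$ and $(q^{k-1},\dots,q,1,q^k)$, where $e_i$ are the standard basis vectors. Then $S$ does not have the integer decomposition property.
   Context: A lattice simplex $S\subset\mathbb{R}^{d}$ with vertices $v_0,\dots,v_d$ has the integer decomposition property (IDP) if every lattice point in the non-negative cone generated by the lifted vertices $(1,v_0),\dots,(1,v_d)$ is a sum of lattice points of that cone having height (the coordinate that was prepended) equal to $1$.
   Formalization: The formal theorem assumes k ≥ 2 instead of k ≥ 1: for k = 1 the simplex is the triangle with vertices (0,0), (1,0), (1,q), which does have the integer decomposition property for every q ≥ 2, so the claim fails there. *)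

theory Defs
  imports "HOL-Analysis.Analysis"
begin

text \<open>
  The space containing a simplex \<open>S\<close> is lifted by prepending the height, so the lifted space is
  \<^typ>\<open>real \<times> (real ^ 'n)\<close>. The vertices of \<open>S\<close> are recovered from \<open>S\<close> as its extreme points.
\<close>

definition lifted_cone :: "(real ^ 'n) set \<Rightarrow> (real \<times> (real ^ 'n)) set" where
  "lifted_cone S = convex_cone hull (Pair 1 ` {v. v extreme_point_of S})"

definition lattice_points :: "(real \<times> (real ^ 'n)) set \<Rightarrow> (real \<times> (real ^ 'n)) set" where
  "lattice_points C = {p \<in> C. fst p \<in> \<int> \<and> (\<forall>i. snd p $ i \<in> \<int>)}"

definition has_IDP :: "(real ^ 'n) set \<Rightarrow> bool" where
  "has_IDP S \<longleftrightarrow>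
     (\<forall>p \<in> lattice_points (lifted_cone S).
        \<exists>ps. set ps \<subseteq> {r \<in> lattice_points (lifted_cone S). fst r = 1} \<and> p = sum_list ps)"

text \<open>
  The index type \<^typ>\<open>'n\<close> of the ambient space carries no canonical order, so the coordinates are
  numbered \<open>1, \<dots>, d\<close> by a function \<open>c\<close> that is meant to be a bijection from \<open>{1..d}\<close> onto
  \<^typ>\<open>'n\<close>; \<open>axis (c i) 1\<close> is the standard basis vector \<open>e\<^sub>i\<close>.
\<close>

definition one_row_hnf_simplex ::
    "(nat \<Rightarrow> 'n::finite) \<Rightarrow> nat \<Rightarrow> (nat \<Rightarrow> int) \<Rightarrow> (real ^ 'n) set" where
  "one_row_hnf_simplex c d a =
     convex hull ({0} \<union> (\<lambda>i. axis (c i) 1) ` {1..<d}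
                   \<union> {\<Sum>i=1..d. real_of_int (a i) *\<^sub>R axis (c i) 1})"

text \<open>The row \<open>(q\<^sup>k\<^sup>-\<^sup>1, \<dots>, q, 1, q\<^sup>k)\<close>, with entries numbered \<open>1, \<dots>, k + 1\<close>.\<close>

definition power_row :: "int \<Rightarrow> nat \<Rightarrow> nat \<Rightarrow> int" where
  "power_row q k i = (if i \<le> k then q ^ (k - i) else q ^ k)"

text \<open>
  For \<open>k = 1\<close> the simplex is the triangle with vertices \<open>(0,0)\<close>, \<open>(1,0)\<close>, \<open>(1,q)\<close>, which, like
  every lattice polygon, does have the integer decomposition property. The negative result
  therefore needs \<open>k \<ge> 2\<close>.
\<close>

lemma lifted_cone_Pair_1:
  assumes "compact S" "convex S" "x \<in> S"
  shows "(1, x) \<in> lifted_cone S"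
proof -
  let ?E = "{v. v extreme_point_of S}"
  have "convex {y. (1::real, y) \<in> lifted_cone S}"
  proof (rule convexI)
    fix x y and u v :: real
    assume *: "x \<in> {y. (1, y) \<in> lifted_cone S}" "y \<in> {y. (1, y) \<in> lifted_cone S}"
      "0 \<le> u" "0 \<le> v" "u + v = 1"
    have "u *\<^sub>R (1, x) + v *\<^sub>R (1, y) \<in> lifted_cone S"
      using * unfolding lifted_cone_def
      by (intro convex_cone_hull_add convex_cone_hull_mul) auto
    then show "u *\<^sub>R x + v *\<^sub>R y \<in> {y. (1, y) \<in> lifted_cone S}"
      using * by simp
  qed
  moreover have "?E \<subseteq> {y. (1::real, y) \<in> lifted_cone S}"
    unfolding lifted_cone_def by (auto intro!: hull_inc)
  ultimately have "convex hull ?E \<subseteq> {y. (1::real, y) \<in> lifted_cone S}"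
    by (intro hull_minimal)
  then show ?thesis
    using Krein_Milman_Minkowski[OF assms(1,2)] assms(3) by auto
qed

lemma has_IDP_power_row_1:
  fixes c :: "nat \<Rightarrow> 'n::finite"
  assumes "q \<ge> 2" and bij: "bij_betw c {1..2} UNIV"
  shows "has_IDP (one_row_hnf_simplex c 2 (power_row q 1))"
proof -
  define S where "S = one_row_hnf_simplex c 2 (power_row q 1)"
  define a b where "a = c 1" and "b = c 2"
  define e1 e2 where "e1 = (axis a 1 :: real ^ 'n)" and "e2 = (axis b 1 :: real ^ 'n)"
  define w where "w = (\<lambda>j::int. e1 + real_of_int j *\<^sub>R e2)"
  have c12: "a \<noteq> b"
    using inj_onD[OF bij_betw_imp_inj_on[OF bij], of 1 2] unfolding a_def b_def by auto
  have set12: "{1..2::nat} = {1, 2}" by auto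
  have univ: "i = a \<or> i = b" for i
    using bij unfolding bij_betw_def set12 a_def b_def by auto
  have e_nth: "e1 $ a = 1" "e1 $ b = 0" "e2 $ a = 0" "e2 $ b = 1"
    using c12 by (auto simp: e1_def e2_def axis_def)
  have S: "S = convex hull {0, e1, w q}"
  proof -
    have "(\<Sum>i=1..2. real_of_int (power_row q 1 i) *\<^sub>R axis (c i) (1::real)) = w q"
      unfolding set12 by (simp add: power_row_def w_def e1_def e2_def a_def b_def)
    moreover have "{1..<2::nat} = {1}" by auto
    ultimately show ?thesis
      by (simp add: S_def one_row_hnf_simplex_def e1_def a_def insert_commute)
  qed
  have "compact S" "convex S"
    unfolding S by (simp_all add: finite_imp_compact_convex_hull)
  have zero: "(1, 0) \<in> lifted_cone S"
    by (rule lifted_cone_Pair_1[OF \<open>compact S\<close> \<open>convex S\<close>]) (auto simp: S intro: hull_inc)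
  have wj: "(1, w j) \<in> lifted_cone S" if j: "0 \<le> j" "j \<le> q" for j
  proof (rule lifted_cone_Pair_1[OF \<open>compact S\<close> \<open>convex S\<close>])
    have "(1 - j / q) *\<^sub>R e1 + (j / q) *\<^sub>R w q \<in> S"
      unfolding S using j \<open>q \<ge> 2\<close>
      by (intro convexD[OF convex_convex_hull]) (auto intro: hull_inc)
    also have "(1 - j / q) *\<^sub>R e1 + (j / q) *\<^sub>R w q = w j"
      using \<open>q \<ge> 2\<close> by (simp add: w_def algebra_simps)
    finally show "w j \<in> S" .
  qed
  define G where "G = {r \<in> lattice_points (lifted_cone S). fst r = 1}"
  have int_e: "e1 $ j \<in> \<int>" "e2 $ j \<in> \<int>" for j
    by (auto simp: e1_def e2_def axis_def)
  have zeroG: "(1, 0) \<in> G"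
    using zero by (simp add: G_def lattice_points_def)
  have wG: "(1, w j) \<in> G" if "0 \<le> j" "j \<le> q" for j
    using wj[OF that] int_e by (auto simp: G_def lattice_points_def w_def)
  have zeros: "\<exists>ps. set ps \<subseteq> G \<and> (real n, 0) = sum_list ps" for n
  proof (induction n)
    case 0
    show ?case by (rule exI[of _ "[]"]) (auto simp: zero_prod_def)
  next
    case (Suc n)
    then obtain ps where "set ps \<subseteq> G" "(real n, 0) = sum_list ps" by auto
    with zeroG show ?case
      by (intro exI[of _ "(1, 0) # ps"]) (auto simp flip: \<open>(real n, 0) = sum_list ps\<close>)
  qed
  have main: "\<exists>ps. set ps \<subseteq> G \<and>
      (real m + real n, real m *\<^sub>R e1 + real_of_int y *\<^sub>R e2) = sum_list ps"
    if "0 \<le> y" "y \<le> q * int m" for m n y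
    using that
  proof (induction m arbitrary: y)
    case 0
    with zeros[of n] show ?case by auto
  next
    case (Suc m)
    define j where "j = min y q"
    have j: "0 \<le> j" "j \<le> q" "0 \<le> y - j" "y - j \<le> q * int m"
      using Suc.prems \<open>q \<ge> 2\<close> by (auto simp: j_def min_def algebra_simps)
    from Suc.IH[OF j(3,4)] obtain ps where ps: "set ps \<subseteq> G"
      "(real m + real n, real m *\<^sub>R e1 + real_of_int (y - j) *\<^sub>R e2) = sum_list ps" by auto
    have "(real (Suc m) + real n, real (Suc m) *\<^sub>R e1 + real_of_int y *\<^sub>R e2)
        = sum_list ((1, w j) # ps)"
      by (simp flip: ps(2) add: w_def algebra_simps)
    with ps(1) wG[OF j(1,2)] show ?case
      by (intro exI[of _ "(1, w j) # ps"]) auto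
  qed
  let ?C = "{p :: real \<times> (real ^ 'n). 0 \<le> snd p $ b \<and> snd p $ b \<le> q * snd p $ a
      \<and> snd p $ a \<le> fst p}"
  have "lifted_cone S \<subseteq> ?C"
    unfolding lifted_cone_def
  proof (rule hull_minimal)
    have "{v. v extreme_point_of S} \<subseteq> {0, e1, w q}"
      unfolding S using extreme_point_of_convex_hull by blast
    then show "Pair 1 ` {v. v extreme_point_of S} \<subseteq> ?C"
      using \<open>q \<ge> 2\<close> by (auto simp: w_def e_nth)
    show "convex_cone ?C"
      by (auto simp: convex_cone_iff mult_left_mono algebra_simps
            intro: add_mono mult_nonneg_nonneg)
  qed
  have "\<exists>ps. set ps \<subseteq> G \<and> p = sum_list ps" if p: "p \<in> lattice_points (lifted_cone S)" for p
  proof -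
    have "p \<in> ?C" and "fst p \<in> \<int>" "snd p $ a \<in> \<int>" "snd p $ b \<in> \<int>"
      using p \<open>lifted_cone S \<subseteq> ?C\<close> by (auto simp: lattice_points_def)
    then obtain h x y :: int where
      hxy: "fst p = h" "snd p $ a = x" "snd p $ b = y"
      by (auto elim!: Ints_cases)
    have "0 \<le> real_of_int y" "real_of_int y \<le> real_of_int (q * x)" "real_of_int x \<le> h"
      using \<open>p \<in> ?C\<close> by (auto simp: hxy)
    then have ineq: "0 \<le> y" "y \<le> q * x" "x \<le> h"
      unfolding of_int_le_iff by auto
    then have "0 \<le> x"
      using \<open>q \<ge> 2\<close> by (smt (verit) zero_le_mult_iff)
    have "snd p = real_of_int x *\<^sub>R e1 + real_of_int y *\<^sub>R e2"
    proof (unfold vec_eq_iff, rule allI)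
      fix i
      show "snd p $ i = (real_of_int x *\<^sub>R e1 + real_of_int y *\<^sub>R e2) $ i"
        using univ[of i] hxy e_nth by auto
    qed
    then have "p = (real (nat x) + real (nat (h - x)),
        real (nat x) *\<^sub>R e1 + real_of_int y *\<^sub>R e2)"
      using hxy(1) \<open>0 \<le> x\<close> ineq(3) by (simp add: prod_eq_iff)
    with main[of y "nat x" "nat (h - x)"] ineq \<open>0 \<le> x\<close> show ?thesis by simp
  qed
  then show ?thesis
    unfolding has_IDP_def G_def S_def by blast
qed

end

theory Submission
  imports Defs
begin

text \<open>
  Write \<open>t\<close> for the last coordinate. The point \<open>(k; 1, \<dots>, 1)\<close> lies in the lifted cone. If it were
  a sum of lattice points of height 1, then, since \<open>t \<ge> 0\<close> on the cone, one of the summands would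
  have \<open>t = 1\<close>. On the cone \<open>x\<^sub>1 \<ge> t / q\<close> and \<open>x\<^sub>k \<ge> t / q\<^sup>k\<close>, so this summand has
  \<open>x\<^sub>1, x\<^sub>k \<ge> 1\<close>. But the height is at least \<open>(x\<^sub>1 - t / q) + x\<^sub>k\<close> on the cone, which is then at
  least \<open>2 - 1 / q > 1\<close>.
\<close>

lemma sum_axis_nth:
  assumes "inj_on c A" "finite A" "j \<in> A"
  shows "(\<Sum>i\<in>A. f i *\<^sub>R axis (c i) (1::real)) $ c j = f j"
proof -
  have "(\<Sum>i\<in>A. f i *\<^sub>R axis (c i) (1::real)) $ c j = (\<Sum>i\<in>A. if i = j then f i else 0)"
    unfolding sum_component
    by (rule sum.cong) (use assms in \<open>auto simp: axis_def inj_on_eq_iff\<close>)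
  then show ?thesis
    using assms by simp
qed

lemma convex_cone_sum:
  assumes "convex_cone C" "\<And>i. i \<in> A \<Longrightarrow> f i \<in> C"
  shows "sum f A \<in> C"
  using assms(2)
proof (induction A rule: infinite_finite_induct)
  case (insert x F)
  then show ?case
    using assms(1) by (auto simp: convex_cone_iff)
qed (use assms(1) in \<open>auto simp: convex_cone_iff\<close>)

text \<open>Extreme points of \<open>convex hull V\<close> belong to \<open>V\<close>, so
  homogeneous linear inequalities that hold on the lifted points of \<open>V\<close> pass to the
  whole lifted cone.\<close>

lemma lifted_cone_convex_hull_subset:
  assumes "convex_cone C" "Pair 1 ` V \<subseteq> C"
  shows "lifted_cone (convex hull V) \<subseteq> C"
  unfolding lifted_cone_def
proof (rule hull_minimal)
  show "Pair 1 ` {v. v extreme_point_of convex hull V} \<subseteq> C"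
    using assms(2) extreme_point_of_convex_hull by blast
qed (fact assms(1))

text \<open>This rests on Krein-Milman through \<open>lifted_cone_Pair_1\<close>, so the extremality
  of \<open>v\<close> never has to be established.\<close>

lemma Pair_1_in_lifted_cone_convex_hull:
  assumes "finite V" "v \<in> V"
  shows "(1, v) \<in> lifted_cone (convex hull V)"
  using assms by (intro lifted_cone_Pair_1) (auto simp: finite_imp_compact_convex_hull hull_inc)

text \<open>An explicit non-negative combination of lifted vertices gives the point. With
  \<open>r = 1 / q\<close>, the vector \<open>r ^ k *\<^sub>R w\<close> has last coordinate 1 and
  \<open>j\<close>-th coordinate \<open>r ^ j \<le> 1\<close>. The unit vectors fill the gaps
  \<open>1 - r ^ j\<close>, and the lifted origin supplies the missing height.\<close>

lemma ones_in_lifted_cone_power_row: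
  fixes c :: "nat \<Rightarrow> 'n::finite"
  assumes "k \<ge> 1" "q \<ge> 1"
  shows "(real k, \<Sum>j=1..k + 1. axis (c j) 1)
    \<in> lifted_cone (one_row_hnf_simplex c (k + 1) (power_row q k))"
proof -
  define e where "e = (\<lambda>j. axis (c j) (1::real))"
  define w where "w = (\<Sum>i=1..k + 1. real_of_int (power_row q k i) *\<^sub>R e i)"
  define r where "r = 1 / real_of_int q"
  define L where "L = lifted_cone (one_row_hnf_simplex c (k + 1) (power_row q k))"
  have r: "0 \<le> r" "r \<le> 1"
    using \<open>q \<ge> 1\<close> by (auto simp: r_def)
  have cone: "convex_cone L"
    unfolding L_def lifted_cone_def by (rule convex_cone_convex_cone_hull)
  have vertex: "(1, v) \<in> L" if "v \<in> {0} \<union> e ` {1..<k + 1} \<union> {w}" for v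
    using that unfolding L_def one_row_hnf_simplex_def e_def w_def
    by (intro Pair_1_in_lifted_cone_convex_hull) auto
  have scale: "a *\<^sub>R x \<in> L" if "x \<in> L" "0 \<le> a" for a x
    using cone that by (auto simp: convex_cone_iff)
  have add: "x + y \<in> L" if "x \<in> L" "y \<in> L" for x y
    using cone that by (auto simp: convex_cone_iff)
  have "(\<Sum>j=1..k. (1 - r ^ j) *\<^sub>R (1, e j)) + r ^ k *\<^sub>R (1, w) + (\<Sum>j=1..<k. r ^ j) *\<^sub>R (1, 0) \<in> L"
    using r by (intro add convex_cone_sum[OF cone] scale vertex sum_nonneg)
      (auto simp: power_le_one)
  also have "(\<Sum>j=1..k. (1 - r ^ j) *\<^sub>R (1::real, e j)) + r ^ k *\<^sub>R (1, w)
      + (\<Sum>j=1..<k. r ^ j) *\<^sub>R (1, 0) = (real k, \<Sum>j=1..k + 1. e j)"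
  proof (rule prod_eqI)
    \<comment> \<open>The unit vectors and \<open>w\<close> have total weight \<open>k\<close> minus
      the sum of \<open>r ^ j\<close> over \<open>1 \<le> j < k\<close>; the weight of the origin is
      exactly this deficit.\<close>
    have "{1..k} = insert k {1..<k}"
      using \<open>k \<ge> 1\<close> by auto
    then have "(\<Sum>j=1..k. r ^ j) = r ^ k + (\<Sum>j=1..<k. r ^ j)"
      by simp
    then show "fst ((\<Sum>j=1..k. (1 - r ^ j) *\<^sub>R (1::real, e j)) + r ^ k *\<^sub>R (1, w)
        + (\<Sum>j=1..<k. r ^ j) *\<^sub>R (1, 0)) = fst (real k, \<Sum>j=1..k + 1. e j)"
      by (simp add: fst_sum sum_subtractf)
    have "r ^ k * real_of_int (power_row q k j) = r ^ j" if "j \<in> {1..k}" for j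
    proof -
      have "r ^ k = r ^ j * r ^ (k - j)"
        using that by (simp flip: power_add)
      then show ?thesis
        using that \<open>q \<ge> 1\<close> by (simp add: power_row_def r_def power_one_over)
    qed
    moreover have "r ^ k * real_of_int (power_row q k (k + 1)) = 1"
      using \<open>q \<ge> 1\<close> by (simp add: power_row_def r_def power_one_over)
    ultimately have "r ^ k *\<^sub>R w = (\<Sum>j=1..k. r ^ j *\<^sub>R e j) + e (k + 1)"
      by (simp add: w_def scaleR_add_right scaleR_sum_right)
    then show "snd ((\<Sum>j=1..k. (1 - r ^ j) *\<^sub>R (1::real, e j)) + r ^ k *\<^sub>R (1, w)
        + (\<Sum>j=1..<k. r ^ j) *\<^sub>R (1, 0)) = snd (real k, \<Sum>j=1..k + 1. e j)"
      by (simp add: snd_sum algebra_simps sum_subtractf)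
  qed
  finally show ?thesis
    by (simp add: L_def e_def)
qed

text \<open>The four inequalities are linear and homogeneous, so they cut out a convex cone
  \<open>C\<close>, and it suffices to check them at the lifted vertices.\<close>

lemma lifted_cone_power_row_bounds:
  fixes c :: "nat \<Rightarrow> 'n::finite"
  assumes "k \<ge> 2" "q \<ge> 1" and inj: "inj_on c {1..k + 1}"
    and p: "p \<in> lifted_cone (one_row_hnf_simplex c (k + 1) (power_row q k))"
  shows "0 \<le> snd p $ c (k + 1)"
    and "snd p $ c (k + 1) \<le> real_of_int q * snd p $ c 1"
    and "snd p $ c (k + 1) \<le> real_of_int q ^ k * snd p $ c k"
    and "snd p $ c 1 - snd p $ c (k + 1) / real_of_int q + snd p $ c k \<le> fst p"
proof -
  define w where "w = (\<Sum>i=1..k + 1. real_of_int (power_row q k i) *\<^sub>R axis (c i) (1::real))"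
  define C where "C = {p :: real \<times> (real ^ 'n). 0 \<le> snd p $ c (k + 1)
    \<and> snd p $ c (k + 1) \<le> real_of_int q * snd p $ c 1
    \<and> snd p $ c (k + 1) \<le> real_of_int q ^ k * snd p $ c k
    \<and> snd p $ c 1 - snd p $ c (k + 1) / real_of_int q + snd p $ c k \<le> fst p}"
  have w: "w $ c j = real_of_int (power_row q k j)" if "j \<in> {1..k + 1}" for j
    unfolding w_def by (rule sum_axis_nth[OF inj _ that]) simp
  have "lifted_cone (one_row_hnf_simplex c (k + 1) (power_row q k)) \<subseteq> C"
    unfolding one_row_hnf_simplex_def w_def[symmetric]
  proof (rule lifted_cone_convex_hull_subset)
    show "convex_cone C"
      unfolding convex_cone_iff
    proof (intro conjI ballI allI impI)
      fix x y assume "x \<in> C" "y \<in> C"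
      then show "x + y \<in> C"
        by (auto simp: C_def algebra_simps add_divide_distrib)
    next
      fix x and a :: real assume "x \<in> C" "0 \<le> a"
      then show "a *\<^sub>R x \<in> C"
        using mult_left_mono[OF _ \<open>0 \<le> a\<close>] by (fastforce simp: C_def algebra_simps)
    qed (auto simp: C_def)
    have "(1, axis (c j) 1) \<in> C" if "j \<in> {1..<k + 1}" for j
    proof -
      have "c j \<noteq> c (k + 1)" "c 1 \<noteq> c k"
        \<comment> \<open>Here \<open>k \<ge> 2\<close> is essential: for \<open>k = 1\<close> the
          vertex \<open>axis (c 1) 1\<close> would count twice in the height bound and violate
          it.\<close>
        using inj_onD[OF inj, of j "k + 1"] inj_onD[OF inj, of 1 k] that \<open>k \<ge> 2\<close> by auto
      then show ?thesis
        using \<open>q \<ge> 1\<close> by (auto simp: C_def axis_def)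
    qed
    moreover have "(1, w) \<in> C"
    proof -
      \<comment> \<open>At \<open>w\<close> the first two terms of the height bound thus cancel,
        leaving \<open>1 \<le> 1\<close>. The second and third inequalities are equalities there
        too.\<close>
      have "real_of_int q ^ k = real_of_int q * real_of_int q ^ (k - 1)"
        using \<open>k \<ge> 2\<close> by (cases k) auto
      then show ?thesis
        using \<open>q \<ge> 1\<close> \<open>k \<ge> 2\<close> w[of 1] w[of k] w[of "k + 1"] by (auto simp: C_def power_row_def)
    qed
    ultimately show "Pair 1 ` ({0} \<union> (\<lambda>i. axis (c i) 1) ` {1..<k + 1} \<union> {w}) \<subseteq> C"
      by (auto simp: C_def)
  qed
  with p have "p \<in> C" by blast
  then show "0 \<le> snd p $ c (k + 1)"
    and "snd p $ c (k + 1) \<le> real_of_int q * snd p $ c 1"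
    and "snd p $ c (k + 1) \<le> real_of_int q ^ k * snd p $ c k"
    and "snd p $ c 1 - snd p $ c (k + 1) / real_of_int q + snd p $ c k \<le> fst p"
    by (simp_all add: C_def)
qed

text \<open>Some summand is nonzero. It is at most the whole sum by non-negativity and at least 1 by
  integrality.\<close>

lemma sum_list_nonneg_int_eq_1:
  fixes xs :: "real list"
  assumes "\<And>x. x \<in> set xs \<Longrightarrow> x \<in> \<int> \<and> 0 \<le> x" and "sum_list xs = 1"
  shows "1 \<in> set xs"
proof -
  have "sum_list xs = 0" if "\<forall>x\<in>set xs. x = 0"
    using that by (induction xs) auto
  then obtain x where x: "x \<in> set xs" "x \<noteq> 0"
    using assms(2) by auto
  have "x \<le> 1"
    using member_le_sum_list[OF x(1)] assms by simp
  moreover have "1 \<le> x"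
    using assms(1)[OF x(1)] x(2) by (auto elim!: Ints_cases)
  ultimately show ?thesis
    using x(1) by (metis antisym)
qed

theorem proposition3p8:
  fixes k :: nat and q :: int and c :: "nat \<Rightarrow> 'n::finite"
  assumes "k \<ge> 2" and "q \<ge> 2"
    and "bij_betw c {1..k + 1} (UNIV :: 'n set)"
  shows "\<not> has_IDP (one_row_hnf_simplex c (k + 1) (power_row q k))"
proof
  define L where "L = lifted_cone (one_row_hnf_simplex c (k + 1) (power_row q k))"
  define p where "p = (real k, \<Sum>j=1..k + 1. axis (c j) (1::real))"
  assume "has_IDP (one_row_hnf_simplex c (k + 1) (power_row q k))"
  moreover have inj: "inj_on c {1..k + 1}"
    using assms(3) by (rule bij_betw_imp_inj_on)
  have p_nth: "snd p $ c j = 1" if "j \<in> {1..k + 1}" for j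
    using sum_axis_nth[OF inj _ that, of "\<lambda>_. 1"] by (simp add: p_def)
  have "p \<in> lattice_points L"
  proof -
    have "p \<in> L"
      using ones_in_lifted_cone_power_row[of k q c] assms(1,2) by (simp add: p_def L_def)
    moreover have "snd p $ i \<in> \<int>" for i
    proof -
      have "i \<in> c ` {1..k + 1}"
        using assms(3) by (simp add: bij_betw_def)
      then show ?thesis
        using p_nth by auto
    qed
    ultimately show ?thesis
      by (simp add: lattice_points_def p_def)
  qed
  ultimately obtain ps where ps: "set ps \<subseteq> {r \<in> lattice_points L. fst r = 1}" "p = sum_list ps"
    unfolding has_IDP_def L_def by blast
  note bounds = lifted_cone_power_row_bounds[OF assms(1) _ inj, of q, folded L_def]
  define t where "t = (\<lambda>r :: real \<times> (real ^ 'n). snd r $ c (k + 1))"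
  have "sum_list (map t qs) = t (sum_list qs)" for qs
    by (induction qs) (auto simp: t_def)
  then have "sum_list (map t ps) = 1"
    using ps(2) p_nth[of "k + 1"] by (simp add: t_def)
  moreover have "t r \<in> \<int> \<and> 0 \<le> t r" if "r \<in> set ps" for r
    using that ps(1) bounds(1)[of r] assms(2) by (auto simp: t_def lattice_points_def)
  ultimately have "1 \<in> set (map t ps)"
    by (intro sum_list_nonneg_int_eq_1) auto
  then obtain r where r: "r \<in> L" "fst r = 1" "snd r $ c (k + 1) = 1"
      and int: "snd r $ i \<in> \<int>" for i
    using ps(1) by (force simp: t_def lattice_points_def)
  have ge_1: "1 \<le> x" if "x \<in> \<int>" "1 \<le> a * x" "0 \<le> a" for a x :: real
  proof -
    have "0 < x"
      using that(2,3) by (metis mult_nonneg_nonpos not_le not_one_le_zero order_trans)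
    then show ?thesis
      using that(1) by (auto elim!: Ints_cases)
  qed
  \<comment> \<open>The cone alone gives only the lower bounds \<open>1 / q\<close> and
    \<open>1 / q ^ k\<close>; integrality of \<open>r\<close> lifts both to 1.\<close>
  have "1 \<le> snd r $ c 1" "1 \<le> snd r $ c k"
    using bounds(2,3)[OF _ r(1)] r(3) assms(2) int
    by (auto intro: ge_1[of _ "real_of_int q"] ge_1[of _ "real_of_int q ^ k"])
  \<comment> \<open>This strict inequality, from \<open>q \<ge> 2\<close>, pushes the left-hand side
    of the height bound above 1.\<close>
  moreover have "1 / real_of_int q < 1"
    using assms(2) by simp
  moreover have "snd r $ c 1 - 1 / real_of_int q + snd r $ c k \<le> 1"
    using bounds(4)[OF _ r(1)] r(2,3) assms(2) by simp
  ultimately show False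
    by linarith
qed

end
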